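(* Without any restriction on the distribution of the $\mathbb{C}^d$-valued random vector $Z$, the statistic $T_n$ satisfies \[ \lim_{n\to\infty}\frac{T_n}{n}=\Delta\qquad \mathbb{P}\text{-almost surely}, \] where \[ \Delta=\int_\Theta\int_{\mathbb{R}^{2d}}\big|\varphi^\ast_{W}(s)-\varphi^\ast_{W_\vartheta}(s)\big|^2\,w(\|s\|)\,\mathrm{d}s\,\mathrm{d}\vartheta . \]
   Context: Let $d\ge 1$ be a fixed integer, $\Theta:=[-\pi,\pi)$, and let $Z,Z_1,Z_2,\ldots$ be independent and identically distributed $\mathbb{C}^d$-valued random vectors defined on a common probability space $(\Omega,\mathcal{A},\mathbb{P})$. For $z=(z_1,\ldots,z_d)^\top\in\mathbb{C}^d$ put $\mathrm{RI}(z):=(\mathrm{Re}\,z_1,\ldots,\mathrm{Re}\,z_d,\mathrm{Im}\,z_1,\ldots,\mathrm{Im}\,z_d)^\top\in\mathbb{R}^{2d}$. Set $W:=\mathrm{RI}(Z)$, $W_j:=\mathrm{RI}(Z_j)$, $W_\vartheta:=\mathrm{RI}(\mathrm{e}^{\mathrm{i}\vartheta}Z)=M_\vartheta W$ and $W_{\vartheta,j}:=\mathrm{RI}(\mathrm{e}^{\mathrm{i}\vartheta}Z_j)=M_\vartheta W_j$ for $\vartheta\in\Theta$, where \[ M_\vartheta=\begin{pmatrix}\cos\vartheta\,\mathrm{I}_d&-\sin\vartheta\,\mathrm{I}_d\\ \sin\vartheta\,\mathrm{I}_d&\cos\vartheta\,\mathrm{I}_d\end{pmatrix} \] and $\mathrm{I}_d$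 is the unit matrix of order $d$. For an $\mathbb{R}^{2d}$-valued random vector $U$, $\varphi^\ast_U(t):=\mathbb{E}[\exp(\mathrm{i}t^\top U)]$, $t\in\mathbb{R}^{2d}$, denotes its characteristic function. The empirical characteristic functions are $\varphi_n^\ast(s):=\frac1n\sum_{j=1}^n\exp(\mathrm{i}s^\top W_j)$ and $\varphi_{n,\vartheta}^\ast(s):=\frac1n\sum_{j=1}^n\exp(\mathrm{i}s^\top W_{\vartheta,j})$, $s\in\mathbb{R}^{2d}$. Let $\|\cdot\|$ be the Euclidean norm on $\mathbb{R}^{2d}$, and let $w:[0,\infty)\to(0,\infty)$ be a measurable function such that $s\mapsto w(\|s\|)$ is (Lebesgue) integrable on $\mathbb{R}^{2d}$. The test statistic is \[ T_n=n\int_\Theta\int_{\mathbb{R}^{2d}}\big|\varphi_n^\ast(s)-\varphi_{n,\vartheta}^\ast(s)\big|^2\,w(\|s\|)\,\mathrm{d}s\,\mathrm{d}\vartheta . \] *)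

theory Defs
  imports "HOL-Probability.Probability"
begin

(* Coordinates of R^{2d} are indexed by 'd + 'd: Inl k carries the k-th real part,
   Inr k the k-th imaginary part. *)
definition RI :: "complex ^ 'd::finite \<Rightarrow> real ^ ('d + 'd)" where
  "RI z = (\<chi> i. case i of Inl k \<Rightarrow> Re (z $ k) | Inr k \<Rightarrow> Im (z $ k))"

definition rotate_vec :: "real \<Rightarrow> complex ^ 'd::finite \<Rightarrow> complex ^ 'd::finite" where
  "rotate_vec \<theta> z = exp (\<i> * complex_of_real \<theta>) *s z"

definition rot_matrix :: "real \<Rightarrow> real ^ ('d::finite + 'd) ^ ('d + 'd)" where
  "rot_matrix \<theta> = (\<chi> i j. case (i, j) of
      (Inl k, Inl l) \<Rightarrow> if k = l then cos \<theta> else 0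
    | (Inl k, Inr l) \<Rightarrow> if k = l then - sin \<theta> else 0
    | (Inr k, Inl l) \<Rightarrow> if k = l then sin \<theta> else 0
    | (Inr k, Inr l) \<Rightarrow> if k = l then cos \<theta> else 0)"

lemma RI_rotate_vec:
  fixes z :: "complex ^ 'd::finite"
  shows "RI (rotate_vec \<theta> z) = rot_matrix \<theta> *v RI z"
proof -
  have "RI (rotate_vec \<theta> z) $ i = (rot_matrix \<theta> *v RI z) $ i" for i
  proof -
    have U: "(UNIV :: ('d + 'd) set) = UNIV <+> UNIV" by simp
    show ?thesis
      by (cases i)
        (simp_all add: RI_def rotate_vec_def rot_matrix_def matrix_vector_mult_def U sum.Plus
          Re_exp Im_exp if_distrib[of "\<lambda>a. a * _"] sum.delta cong: if_cong del: UNIV_Plus_UNIV)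
  qed
  then show ?thesis by (simp add: vec_eq_iff)
qed

definition char_fun :: "'w measure \<Rightarrow> ('w \<Rightarrow> 'v::euclidean_space) \<Rightarrow> 'v \<Rightarrow> complex" where
  "char_fun M U t = (\<integral>\<omega>. exp (\<i> * complex_of_real (t \<bullet> U \<omega>)) \<partial>M)"

(* Samples x are sequences of which only the entries x 1, x 2, ... are used. *)
definition emp_char_fun :: "nat \<Rightarrow> (nat \<Rightarrow> 'v::euclidean_space) \<Rightarrow> 'v \<Rightarrow> complex" where
  "emp_char_fun n x s = 1 / of_nat n * (\<Sum>j = 1..n. exp (\<i> * complex_of_real (s \<bullet> x j)))"

definition T_stat :: "(real \<Rightarrow> real) \<Rightarrow> nat \<Rightarrow> (nat \<Rightarrow> complex ^ 'd::finite) \<Rightarrow> real" where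
  "T_stat w n z = real n *
     (LINT \<theta>:{-pi..<pi}|lborel. LINT s|lborel.
        (cmod (emp_char_fun n (\<lambda>j. RI (z j)) s
             - emp_char_fun n (\<lambda>j. RI (rotate_vec \<theta> (z j))) s))\<^sup>2 * w (norm s))"

definition Delta :: "(real \<Rightarrow> real) \<Rightarrow> 'w measure \<Rightarrow> ('w \<Rightarrow> complex ^ 'd::finite) \<Rightarrow> real" where
  "Delta w M Z =
     (LINT \<theta>:{-pi..<pi}|lborel. LINT s|lborel.
        (cmod (char_fun M (\<lambda>\<omega>. RI (Z \<omega>)) s
             - char_fun M (\<lambda>\<omega>. RI (rotate_vec \<theta> (Z \<omega>))) s))\<^sup>2 * w (norm s))"

end

theory Submission imports Defs
begin

text \<open>
  The difference of the two empirical characteristic functions is, at a fixed pair of an angle and a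
  frequency, an average of bounded i.i.d. variables, so it converges almost surely by a strong law
  (Hoeffding's inequality and the Borel--Cantelli lemma). Fubini's theorem exchanges the
  quantifiers: almost surely, convergence holds for almost every pair of angle and frequency. The
  integrands are at most \<open>4 w(\<parallel>s\<parallel>)\<close>, so dominated convergence applies to both integrals.
\<close>

section \<open>Strong law of large numbers for bounded variables\<close>

text \<open>Hoeffding's inequality makes the probability of a deviation of at least \<open>e\<close>
  decay geometrically in \<open>n\<close>, hence summably, and Borel-Cantelli applies for each
  \<open>e\<close>. The bound is placed on \<open>Y\<close> alone; equality in law carries it to
  each \<open>X j\<close> almost surely.\<close>

lemma (in prob_space) strong_law_bounded_real:
  fixes X :: "nat \<Rightarrow> 'a \<Rightarrow> real" and Y :: "'a \<Rightarrow> real"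
  assumes indep: "indep_vars (\<lambda>_. borel) X {1..}"
    and Y[measurable]: "random_variable borel Y"
    and distr: "\<And>j. j \<ge> 1 \<Longrightarrow> distr M borel (X j) = distr M borel Y"
    and bdd: "\<And>x. \<bar>Y x\<bar> \<le> B"
  shows "AE x in M. (\<lambda>n. (\<Sum>j = 1..n. X j x) / n) \<longlonglongrightarrow> expectation Y"
proof -
  \<comment> \<open>The \<open>+ 1\<close> keeps the interval \<open>{- c..c}\<close> of positive
    width even for \<open>B = 0\<close>, so the exponent below can be divided by its square.\<close>
  define c where "c = \<bar>B\<bar> + 1"
  have c: "c > 0" by (simp add: c_def)
  have rv[measurable]: "random_variable borel (X j)" if "j \<ge> 1" for j
    using indep that unfolding indep_vars_def by auto
  have rv': "(\<lambda>x. \<Sum>j = 1..n. X j x) \<in> borel_measurable M" for n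
    by (intro borel_measurable_sum rv) auto
  define A where "A e n = {x \<in> space M. \<bar>(\<Sum>j = 1..n. X j x) / n - expectation Y\<bar> \<ge> e}"
    for e :: real and n :: nat
  have A_meas[measurable]: "A e n \<in> sets M" for e n
    unfolding A_def using rv'[of n] by measurable
  have bound: "prob (A e n) \<le> 2 * exp (- e\<^sup>2 / (2 * c\<^sup>2)) ^ n" if "e > 0" "n \<ge> 1" for e n
  proof -
    interpret H: Hoeffding_ineq_iid M "{1..n}" X Y "- c" c "expectation Y"
    proof unfold_locales
      show "indep_vars (\<lambda>_. borel) X {1..n}"
        by (rule indep_vars_subset[OF indep]) auto
      show "AE x in M. Y x \<in> {- c..c}"
        using bdd by (intro AE_I2) (smt (verit) c_def atLeastAtMost_iff)
    qed (auto simp: distr)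
    have "prob (A e n) \<le> 2 * exp (- 2 * real n * e\<^sup>2 / (c - - c)\<^sup>2)"
      using H.Hoeffding_ineq_abs_ge'[of e] that c by (simp add: A_def)
    \<comment> \<open>The exponent is linear in \<open>n\<close>, which turns the bound into the
      \<open>n\<close>-th power of a fixed ratio.\<close>
    also have "- 2 * real n * e\<^sup>2 / (c - - c)\<^sup>2 = real n * (- e\<^sup>2 / (2 * c\<^sup>2))"
      using c by (simp add: power2_eq_square field_simps)
    finally show ?thesis by (simp only: exp_of_nat_mult)
  qed
  have "AE x in M. \<forall>\<^sub>F n in sequentially. x \<in> space M - A e n" if "e > 0" for e
  proof (rule borel_cantelli_AE1)
    have "exp (- e\<^sup>2 / (2 * c\<^sup>2)) < 1"
      using that c by simp
    then have "summable (\<lambda>n. 2 * exp (- e\<^sup>2 / (2 * c\<^sup>2)) ^ n)"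
      by (intro summable_mult summable_geometric) simp
    then show "summable (\<lambda>n. prob (A e n))"
      by (rule summable_comparison_test') (use bound that in auto)
  qed (auto simp: emeasure_eq_measure)
  \<comment> \<open>Restricting to the tolerances \<open>1 / Suc k\<close> leaves countably many
    null sets to unite.\<close>
  then have "AE x in M. \<forall>k. \<forall>\<^sub>F n in sequentially. x \<in> space M - A (1 / Suc k) n"
    by (subst AE_all_countable) auto
  then show ?thesis
  proof (rule AE_mp, intro AE_I2 impI)
    fix x assume x: "x \<in> space M"
      and ev: "\<forall>k. \<forall>\<^sub>F n in sequentially. x \<in> space M - A (1 / Suc k) n"
    show "(\<lambda>n. (\<Sum>j = 1..n. X j x) / n) \<longlonglongrightarrow> expectation Y"
    proof (rule tendstoI)
      fix e :: real assume "e > 0"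
      then obtain k where k: "1 / Suc k < e"
        using nat_approx_posE by blast
      show "\<forall>\<^sub>F n in sequentially. dist ((\<Sum>j = 1..n. X j x) / n) (expectation Y) < e"
        using ev[rule_format, of k] by eventually_elim (use x k in \<open>auto simp: A_def dist_real_def\<close>)
    qed
  qed
qed

text \<open>The real law is applied to real and imaginary parts. Both are measurable and bounded by
  the modulus, which is all that \<open>part\<close> asks of \<open>f\<close>.\<close>

lemma (in prob_space) strong_law_bounded_complex:
  fixes X :: "nat \<Rightarrow> 'a \<Rightarrow> complex" and Y :: "'a \<Rightarrow> complex"
  assumes indep: "indep_vars (\<lambda>_. borel) X {1..}"
    and Y[measurable]: "random_variable borel Y"
    and distr: "\<And>j. j \<ge> 1 \<Longrightarrow> distr M borel (X j) = distr M borel Y"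
    and bdd: "\<And>x. cmod (Y x) \<le> B"
  shows "AE x in M. (\<lambda>n. (\<Sum>j = 1..n. X j x) / of_nat n) \<longlonglongrightarrow> expectation Y"
proof -
  have rv[measurable]: "random_variable borel (X j)" if "j \<ge> 1" for j
    using indep that unfolding indep_vars_def by auto
  have part: "AE x in M. (\<lambda>n. (\<Sum>j = 1..n. f (X j x)) / n) \<longlonglongrightarrow> expectation (\<lambda>x. f (Y x))"
    if f[measurable]: "f \<in> borel_measurable borel" and le: "\<And>z. \<bar>f z\<bar> \<le> cmod z" for f
  proof (rule strong_law_bounded_real)
    show "indep_vars (\<lambda>_. borel) (\<lambda>j x. f (X j x)) {1..}"
      by (rule indep_vars_compose2[OF indep]) (rule f)
    show "distr M borel (\<lambda>x. f (X j x)) = distr M borel (\<lambda>x. f (Y x))" if "j \<ge> 1" for j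
    proof -
      have "distr M borel (\<lambda>x. f (X j x)) = distr (distr M borel (X j)) borel f"
        using that by (subst distr_distr) (auto simp: comp_def)
      also have "\<dots> = distr M borel (\<lambda>x. f (Y x))"
        using that by (simp add: distr distr_distr comp_def)
      finally show ?thesis .
    qed
    show "\<bar>f (Y x)\<bar> \<le> B" for x
      using le bdd order_trans by blast
  qed measurable
  have "integrable M Y"
    by (rule integrable_const_bound[where B = B]) (auto simp: bdd)
  then have "expectation (\<lambda>x. Re (Y x)) = Re (expectation Y)"
    "expectation (\<lambda>x. Im (Y x)) = Im (expectation Y)"
    by simp_all
  with part[of Re] part[of Im] show ?thesis
    by (simp add: abs_Re_le_cmod abs_Im_le_cmod tendsto_complex_iff)
qed

section \<open>Exchanging almost sure and almost everywhere\<close>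

text \<open>With tolerances \<open>1 / Suc k\<close>, all quantifiers in the definition of
  convergence range over natural numbers, so the convergence set is a countable combination of
  measurable sets.\<close>

lemma measurable_LIMSEQ_pred:
  fixes f :: "nat \<Rightarrow> 'a \<Rightarrow> 'b::{real_normed_vector, second_countable_topology}"
  assumes [measurable]: "\<And>n. f n \<in> borel_measurable M" "l \<in> borel_measurable M"
  shows "Measurable.pred M (\<lambda>x. (\<lambda>n. f n x) \<longlonglongrightarrow> l x)"
proof -
  have "(\<lambda>n. f n x) \<longlonglongrightarrow> l x \<longleftrightarrow> (\<forall>k. \<exists>N. \<forall>n\<in>{N..}. norm (f n x - l x) < 1 / Suc k)" for x
  proof
    assume conv: "(\<lambda>n. f n x) \<longlonglongrightarrow> l x"
    show "\<forall>k. \<exists>N. \<forall>n\<in>{N..}. norm (f n x - l x) < 1 / Suc k"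
    proof
      fix k
      show "\<exists>N. \<forall>n\<in>{N..}. norm (f n x - l x) < 1 / Suc k"
        using LIMSEQ_D[OF conv, of "1 / Suc k"] by auto
    qed
  next
    assume close: "\<forall>k. \<exists>N. \<forall>n\<in>{N..}. norm (f n x - l x) < 1 / Suc k"
    show "(\<lambda>n. f n x) \<longlonglongrightarrow> l x"
    proof (rule LIMSEQ_I)
      fix e :: real assume "e > 0"
      then obtain k where k: "1 / Suc k < e"
        using nat_approx_posE by blast
      obtain N where "\<forall>n\<in>{N..}. norm (f n x - l x) < 1 / Suc k"
        using close by blast
      then have "\<forall>n\<ge>N. norm (f n x - l x) < e"
        using k order_less_trans by (metis atLeast_iff)
      then show "\<exists>N. \<forall>n\<ge>N. norm (f n x - l x) < e" ..
    qed
  qed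
  then show ?thesis by simp
qed

text \<open>The exceptional null set of the strong law depends on the parameter; Fubini's theorem
  replaces it by one null set of samples, outside which only almost every parameter is covered.\<close>

lemma (in prob_space) strong_law_AE_parameter:
  fixes g :: "'b \<Rightarrow> 'c \<Rightarrow> complex"
  assumes N: "sigma_finite_measure N"
    and indep: "indep_vars (\<lambda>_. S) X {1..}"
    and Y[measurable]: "random_variable S Y"
    and distr: "\<And>j. j \<ge> 1 \<Longrightarrow> distr M S (X j) = distr M S Y"
    and g[measurable]: "case_prod g \<in> borel_measurable (S \<Otimes>\<^sub>M N)"
    and bdd: "\<And>z p. cmod (g z p) \<le> B"
  shows "AE x in M. AE p in N.
    (\<lambda>n. (\<Sum>j = 1..n. g (X j x) p) / of_nat n) \<longlonglongrightarrow> expectation (\<lambda>x. g (Y x) p)"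
proof -
  interpret N: sigma_finite_measure N by (rule N)
  interpret pair_sigma_finite M N ..
  have rv[measurable]: "random_variable S (X j)" if "j \<ge> 1" for j
    using indep that unfolding indep_vars_def by auto
  have pointwise: "AE x in M. (\<lambda>n. (\<Sum>j = 1..n. g (X j x) p) / of_nat n)
      \<longlonglongrightarrow> expectation (\<lambda>x. g (Y x) p)" if p: "p \<in> space N" for p
  proof (rule strong_law_bounded_complex)
    have gp[measurable]: "(\<lambda>z. g z p) \<in> borel_measurable S"
      using p by measurable
    show "indep_vars (\<lambda>_. borel) (\<lambda>j x. g (X j x) p) {1..}"
      by (rule indep_vars_compose2[OF indep]) (rule gp)
    show "(\<lambda>x. g (Y x) p) \<in> borel_measurable M"
      by measurable
    show "distr M borel (\<lambda>x. g (X j x) p) = distr M borel (\<lambda>x. g (Y x) p)" if "j \<ge> 1" for j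
    proof -
      have "distr M borel (\<lambda>x. g (X j x) p) = distr (distr M S (X j)) borel (\<lambda>z. g z p)"
        using that by (subst distr_distr) (auto simp: comp_def)
      also have "\<dots> = distr M borel (\<lambda>x. g (Y x) p)"
        using that by (simp add: distr distr_distr comp_def)
      finally show ?thesis .
    qed
  qed (rule bdd)
  have meas_avg: "(\<lambda>q. (\<Sum>j = 1..n. g (X j (fst q)) (snd q)) / of_nat n)
      \<in> borel_measurable (M \<Otimes>\<^sub>M N)" for n
    by (intro borel_measurable_divide borel_measurable_sum) auto
  have "(\<lambda>p. expectation (\<lambda>x. g (Y x) p)) \<in> borel_measurable N"
    by measurable
  then have meas_lim: "(\<lambda>q. expectation (\<lambda>x. g (Y x) (snd q))) \<in> borel_measurable (M \<Otimes>\<^sub>M N)"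
    by (rule measurable_compose[OF measurable_snd])
  show ?thesis
  \<comment> \<open>Swapping the quantifiers requires the convergence set to be measurable in the
    product space. Afterwards the parameter is outermost, and \<open>pointwise\<close> covers each
    of its values.\<close>
  proof (subst AE_commute)
    show "{q \<in> space (M \<Otimes>\<^sub>M N). (\<lambda>n. (\<Sum>j = 1..n. g (X j (fst q)) (snd q)) / of_nat n)
        \<longlonglongrightarrow> expectation (\<lambda>x. g (Y x) (snd q))} \<in> sets (M \<Otimes>\<^sub>M N)"
      using measurable_LIMSEQ_pred[OF meas_avg meas_lim] by (simp only: pred_def)
  qed (rule AE_I2, rule pointwise)
qed

lemma cmod_exp_diff_le_2: "cmod (exp (\<i> * complex_of_real a) - exp (\<i> * complex_of_real b)) \<le> 2"
  by (rule order_trans[OF norm_triangle_ineq4]) simp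

lemma continuous_on_RI[continuous_intros]:
  assumes "continuous_on A f"
  shows "continuous_on A (\<lambda>x. RI (f x))"
  unfolding RI_def
proof (rule continuous_on_vec_lambda)
  show "continuous_on A (\<lambda>x. case i of Inl k \<Rightarrow> Re (f x $ k) | Inr k \<Rightarrow> Im (f x $ k))" for i
    by (cases i) (auto intro!: continuous_intros assms)
qed

text \<open>The angle \<open>h x\<close> varies along with the vector, since joint continuity in
  sample value, angle and frequency is wanted below.\<close>

lemma continuous_on_rotate_vec[continuous_intros]:
  assumes "continuous_on A f" "continuous_on A h"
  shows "continuous_on A (\<lambda>x. rotate_vec (h x) (f x))"
  unfolding rotate_vec_def vector_scalar_mult_def
  by (intro continuous_on_vec_lambda continuous_intros assms)

section \<open>Almost sure limit of the scaled statistic\<close>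

theorem theorem4p1:
  fixes M :: "'w measure"
    and Z :: "'w \<Rightarrow> complex ^ 'd::finite"
    and Zs :: "nat \<Rightarrow> 'w \<Rightarrow> complex ^ 'd"
    and w :: "real \<Rightarrow> real"
  assumes "prob_space M"
    and "prob_space.indep_vars M (\<lambda>_. borel) (Zs(0 := Z)) UNIV"
    and "\<And>j. j \<ge> 1 \<Longrightarrow> distr M borel (Zs j) = distr M borel Z"
    and "w \<in> borel_measurable (restrict_space borel {0..})"
    and "\<And>r. r \<ge> 0 \<Longrightarrow> w r > 0"
    and "integrable lborel (\<lambda>s :: real ^ ('d + 'd). w (norm s))"
  shows "AE \<omega> in M. (\<lambda>n. T_stat w n (\<lambda>j. Zs j \<omega>) / real n) \<longlonglongrightarrow> Delta w M Z"
proof -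
  interpret prob_space M by fact
  note w_int = assms(6)
  have w_nonneg: "w (norm s) \<ge> 0" for s :: "real ^ ('d + 'd)"
    using assms(5)[of "norm s"] by simp
  \<comment> \<open>On the indices \<open>{1..}\<close> the update at \<open>0\<close> is invisible.
    Index \<open>0\<close> itself supplies the measurability of \<open>Z\<close> further
    down.\<close>
  have indep: "indep_vars (\<lambda>_. borel) Zs {1..}"
  proof -
    have "indep_vars (\<lambda>_. borel) (Zs(0 := Z)) {1..}"
      by (rule indep_vars_subset[OF assms(2)]) auto
    then show ?thesis
      by (rule iffD1[OF indep_vars_cong, rotated -1]) auto
  qed
  have Z[measurable]: "random_variable borel Z"
    using assms(2) unfolding indep_vars_def by (metis UNIV_I fun_upd_same)
  \<comment> \<open>The parameter is the pair of angle and frequency. Sample averages of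
    \<open>g\<close> are differences of empirical characteristic functions (\<open>emp\<close>), and
    its expectation is the difference of the true ones (\<open>chf\<close>).\<close>
  define g where "g z = (\<lambda>(\<theta>, s). exp (\<i> * complex_of_real (s \<bullet> RI z)) -
    exp (\<i> * complex_of_real (s \<bullet> RI (rotate_vec \<theta> z))))"
    for z :: "complex ^ 'd"
  define N where "N = (lborel :: real measure) \<Otimes>\<^sub>M (lborel :: (real ^ ('d + 'd)) measure)"
  have g_le: "cmod (g z p) \<le> 2" for z p
    by (auto simp: g_def cmod_exp_diff_le_2 split: prod.split)
  have g_cont: "continuous_on UNIV (\<lambda>q. g (fst q) (snd q))"
    unfolding g_def case_prod_beta by (intro continuous_intros)
  \<comment> \<open>For these second countable spaces the product of the Borel algebras is the Borel
    algebra of the product, so continuity of \<open>g\<close> gives joint measurability.\<close>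
  have "sets (borel \<Otimes>\<^sub>M N) = sets (borel :: ((complex ^ 'd) \<times> real \<times> (real ^ ('d + 'd))) measure)"
    unfolding N_def borel_prod[symmetric] by (intro sets_pair_measure_cong) auto
  then have g_meas: "case_prod g \<in> borel_measurable (borel \<Otimes>\<^sub>M N)"
    using borel_measurable_continuous_onI[OF g_cont]
    by (simp add: case_prod_beta' cong: measurable_cong_sets)
  have N_sf: "sigma_finite_measure N"
    unfolding N_def lborel_prod by (rule sigma_finite_lborel)
  define avg where "avg n \<omega> p = (\<Sum>j = 1..n. g (Zs j \<omega>) p) / of_nat n" for n \<omega> p
  define lim where "lim p = expectation (\<lambda>\<omega>. g (Z \<omega>) p)" for p
  have emp: "emp_char_fun n (\<lambda>j. RI (Zs j \<omega>)) s - emp_char_fun n (\<lambda>j. RI (rotate_vec \<theta> (Zs j \<omega>))) s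
      = avg n \<omega> (\<theta>, s)" for n \<omega> \<theta> s
    by (simp add: emp_char_fun_def avg_def g_def sum_subtractf diff_divide_distrib)
  have RI_meas[measurable]: "RI \<in> borel_measurable borel"
    "rotate_vec \<theta> \<in> borel_measurable borel" for \<theta>
    by (intro borel_measurable_continuous_onI continuous_intros)+
  have chf: "char_fun M (\<lambda>\<omega>. RI (Z \<omega>)) s - char_fun M (\<lambda>\<omega>. RI (rotate_vec \<theta> (Z \<omega>))) s = lim (\<theta>, s)"
    for \<theta> s
    unfolding char_fun_def lim_def g_def prod.case
    by (rule Bochner_Integration.integral_diff[symmetric];
        rule integrable_const_bound[where B = 1]; simp; measurable)
  have avg_le: "cmod (avg n \<omega> p) \<le> 2" for n \<omega> p
  proof -
    have "cmod (\<Sum>j = 1..n. g (Zs j \<omega>) p) \<le> real n * 2"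
      using sum_norm_bound[of "{1..n}" "\<lambda>j. g (Zs j \<omega>) p" 2] g_le by simp
    then show ?thesis
      by (cases "n = 0") (auto simp: avg_def norm_divide field_simps)
  qed
  have g_sect: "g z \<in> borel_measurable N" for z
    using measurable_compose[OF measurable_Pair1' g_meas, of z] by simp
  have avg_meas: "avg n \<omega> \<in> borel_measurable N" for n \<omega>
    unfolding avg_def[abs_def] by (intro borel_measurable_divide borel_measurable_sum g_sect) auto
  have lim_meas: "lim \<in> borel_measurable N"
  proof -
    \<comment> \<open>The sample point comes second because measurability of a parametrized integral
      is obtained by integrating out the second component.\<close>
    have "(\<lambda>q. g (Z (snd q)) (fst q)) \<in> borel_measurable (N \<Otimes>\<^sub>M M)"
      using g_meas by measurable
    then show ?thesis
      unfolding lim_def[abs_def]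
      by (intro borel_measurable_lebesgue_integral) (simp add: case_prod_beta')
  qed
  have sq_le: "(cmod z)\<^sup>2 * w (norm s) \<le> 4 * w (norm s)" if "cmod z \<le> 2"
    for z and s :: "real ^ ('d + 'd)"
    using power_mono[OF that, of 2] by (intro mult_right_mono w_nonneg) auto
  have w_meas[measurable]: "(\<lambda>s :: real ^ ('d + 'd). w (norm s)) \<in> borel_measurable lborel"
    by (rule borel_measurable_integrable[OF w_int])
  \<comment> \<open>\<open>C\<close> bounds the inner integral uniformly in \<open>n\<close>,
    \<omega> and \<theta>. Being constant, it is an integrable majorant over the finite range of
    angles.\<close>
  define C where "C = 4 * (LINT s|lborel. w (norm (s :: real ^ ('d + 'd))))"
  define I where "I h \<theta> = (LINT s|lborel. (cmod (h (\<theta>, s)))\<^sup>2 * w (norm (s :: real ^ ('d + 'd))))"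
    for h :: "real \<times> (real ^ ('d + 'd)) \<Rightarrow> complex" and \<theta>
  have I_meas: "I h \<in> borel_measurable lborel" if "h \<in> borel_measurable N" for h
  proof -
    have "(\<lambda>q. w (norm (snd q))) \<in> borel_measurable N"
      unfolding N_def by (rule measurable_compose[OF measurable_snd w_meas])
    with that have "(\<lambda>q. (cmod (h q))\<^sup>2 * w (norm (snd q))) \<in> borel_measurable N"
      by (intro borel_measurable_times borel_measurable_power measurable_compose[OF _ borel_measurable_norm])
    then show ?thesis
      unfolding I_def[abs_def] N_def
      by (intro lborel.borel_measurable_lebesgue_integral)
        (simp only: case_prod_beta' fst_conv snd_conv prod.collapse)
  qed
  have I_le: "norm (I (avg n \<omega>) \<theta>) \<le> C" for n \<omega> \<theta>
  proof -
    have "I (avg n \<omega>) \<theta> \<ge> 0"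
      unfolding I_def by (intro integral_nonneg_AE AE_I2 mult_nonneg_nonneg w_nonneg) auto
    moreover have "I (avg n \<omega>) \<theta> \<le> C"
      unfolding I_def C_def integral_mult_right_zero[symmetric]
      by (intro integral_mono' integrable_mult_right w_int sq_le avg_le)
        (use w_nonneg in auto)
    ultimately show ?thesis by simp
  qed
  \<comment> \<open>This part is deterministic: the sample path is fixed, and all randomness sits in
    the hypothesis \<open>conv\<close>.\<close>
  have main: "(\<lambda>n. T_stat w n (\<lambda>j. Zs j \<omega>) / real n) \<longlonglongrightarrow> Delta w M Z"
    if conv: "AE p in N. (\<lambda>n. avg n \<omega> p) \<longlonglongrightarrow> lim p" for \<omega>
  proof -
    \<comment> \<open>Almost every section of a null set of the product is null. Dominated
      convergence is then used first in \<open>s\<close>, with majorant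
      \<open>4 * w (norm s)\<close>, and next in \<theta>, with majorant \<open>C\<close>.\<close>
    have "AE \<theta> in lborel. AE s in lborel. (\<lambda>n. avg n \<omega> (\<theta>, s)) \<longlonglongrightarrow> lim (\<theta>, s)"
      using conv unfolding N_def by (rule lborel_pair.AE_pair)
    then have inner: "AE \<theta> in lborel. (\<lambda>n. I (avg n \<omega>) \<theta>) \<longlonglongrightarrow> I lim \<theta>"
    proof (rule AE_mp, intro AE_I2 impI)
      fix \<theta> assume "AE s in lborel. (\<lambda>n. avg n \<omega> (\<theta>, s)) \<longlonglongrightarrow> lim (\<theta>, s)"
      then show "(\<lambda>n. I (avg n \<omega>) \<theta>) \<longlonglongrightarrow> I lim \<theta>"
        unfolding I_def
      proof (intro integral_dominated_convergence[where w = "\<lambda>s. 4 * w (norm s)"])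
        have section_meas: "(\<lambda>s. (cmod (h (\<theta>, s)))\<^sup>2 * w (norm s)) \<in> borel_measurable lborel"
          if "h \<in> borel_measurable N" for h :: "real \<times> (real ^ ('d + 'd)) \<Rightarrow> complex"
        proof -
          have "(\<lambda>s. h (\<theta>, s)) \<in> borel_measurable lborel"
            using that unfolding N_def by (rule measurable_compose[OF measurable_Pair1', rotated]) simp
          then show ?thesis
            by (intro borel_measurable_times borel_measurable_power measurable_compose[OF _ borel_measurable_norm] w_meas)
        qed
        show "(\<lambda>s. (cmod (lim (\<theta>, s)))\<^sup>2 * w (norm s)) \<in> borel_measurable lborel"
          by (rule section_meas[OF lim_meas])
        show "(\<lambda>s. (cmod (avg n \<omega> (\<theta>, s)))\<^sup>2 * w (norm s)) \<in> borel_measurable lborel" for n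
          by (rule section_meas[OF avg_meas])
        show "AE s in lborel. norm ((cmod (avg n \<omega> (\<theta>, s)))\<^sup>2 * w (norm s)) \<le> 4 * w (norm s)" for n
          using sq_le[OF avg_le] w_nonneg by (simp add: abs_mult)
      qed (use w_int in \<open>auto intro!: tendsto_intros elim!: eventually_mono\<close>)
    qed
    have "(\<lambda>n. LINT \<theta>:{-pi..<pi}|lborel. I (avg n \<omega>) \<theta>) \<longlonglongrightarrow> (LINT \<theta>:{-pi..<pi}|lborel. I lim \<theta>)"
      unfolding set_lebesgue_integral_def
    proof (rule integral_dominated_convergence[where w = "\<lambda>\<theta>. indicator {-pi..<pi} \<theta> *\<^sub>R C"])
      show "integrable lborel (\<lambda>\<theta>::real. indicator {-pi..<pi} \<theta> *\<^sub>R C)"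
        by (intro integrable_scaleR_left) (auto intro!: integrable_real_indicator)
      show "AE \<theta> in lborel. (\<lambda>n. indicator {-pi..<pi} \<theta> *\<^sub>R I (avg n \<omega>) \<theta>)
          \<longlonglongrightarrow> indicator {-pi..<pi} \<theta> *\<^sub>R I lim \<theta>"
        using inner by eventually_elim (intro tendsto_intros)
      show "AE \<theta> in lborel. norm (indicator {-pi..<pi} \<theta> *\<^sub>R I (avg n \<omega>) \<theta>)
          \<le> indicator {-pi..<pi} \<theta> *\<^sub>R C" for n
        using I_le by (auto simp: indicator_def)
      show "(\<lambda>\<theta>. indicator {-pi..<pi} \<theta> *\<^sub>R I lim \<theta>) \<in> borel_measurable lborel"
        by (intro borel_measurable_scaleR I_meas[OF lim_meas]) measurable
      show "(\<lambda>\<theta>. indicator {-pi..<pi} \<theta> *\<^sub>R I (avg n \<omega>) \<theta>) \<in> borel_measurable lborel" for n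
        by (intro borel_measurable_scaleR I_meas[OF avg_meas]) measurable
    qed
    \<comment> \<open>Cancelling the factor \<open>real n\<close> of \<open>T_stat\<close> uses
      \<open>n > 0\<close>, hence the eventual form.\<close>
    moreover have "\<forall>\<^sub>F n in sequentially. (LINT \<theta>:{-pi..<pi}|lborel. I (avg n \<omega>) \<theta>) =
        T_stat w n (\<lambda>j. Zs j \<omega>) / real n"
      using eventually_gt_at_top[of 0]
      by eventually_elim (simp add: T_stat_def emp I_def)
    moreover have "Delta w M Z = (LINT \<theta>:{-pi..<pi}|lborel. I lim \<theta>)"
      by (simp add: Delta_def chf I_def)
    ultimately show ?thesis
      by (auto elim: Lim_transform_eventually)
  qed
  have "AE \<omega> in M. AE p in N. (\<lambda>n. avg n \<omega> p) \<longlonglongrightarrow> lim p"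
    unfolding avg_def lim_def
    by (rule strong_law_AE_parameter[OF N_sf indep Z assms(3) g_meas g_le])
  then show ?thesis
    by (rule eventually_mono) (rule main)
qed

end
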